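(* Let $H$, $A$, $P$, $Q$, $K$, $\alpha$, $\beta$, $F$, $G$, $z$ be as described in the context, and let $\eta\in(\beta,\alpha)$. Let $M(\omega)=\{\xi+h(\xi,\omega)\mid \xi\in PH\}$ be the Lipschitz invariant manifold, constructed in the context (with this $\eta$), of the random evolution equation $$\frac{\mathrm{d}u}{\mathrm{d}t}=Au+z(\theta_t\omega)u+G(\theta_t\omega,u),\qquad u(0)=x\in H .$$ Suppose that the spectral gap condition $$K\,\mathrm{Lip}F\left(\frac{1}{\alpha-\eta}+\frac{1}{\eta-\beta}\right)+K^2\,\mathrm{Lip}h\cdot\mathrm{Lip}F\,\frac{1}{\alpha-\eta}<1$$ holds. Then $M(\omega)$ has the asymptotic completeness property: there is a constant $c_2>0$, independent of $\omega$ and of the initial points, such that for every $\omega\in\Omega$ and every $x\in H$ there exist $\bar x\in M(\omega)$ and a constant $c_1>0$ (which may depend on $\omega,x,\bar x$) with $$|\varphi(t,\omega,x)-\varphi(t,\omega,\bar x)|\le c_1e^{-c_2t}|x-\bar x|\qquad\text{for all } t\ge 0,$$ where $\varphi$ is the random dynamical system generated by the equation.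
   Context: **Noise.** $W$ is the standard two-sided real Wiener process, realized on the canonical space $C_0(\mathbb R,\mathbb R)$ of continuous functions $\omega$ with $\omega(0)=0$, with Wiener measure $\mathbb P$ and shifts $\theta_t\omega(\cdot)=\omega(t+\cdot)-\omega(t)$. $\Omega$ is a $\{\theta_t\}$-invariant set of full measure on which $\omega(t)/t\to0$ as $t\to\pm\infty$ and on which the following holds for the stationary Ornstein–Uhlenbeck process $z(\theta_t\omega)$ solving $\mathrm{d}z+z\,\mathrm{d}t=\mathrm{d}W$, given by $z(\omega)=-\int_{-\infty}^0e^{\tau}\omega(\tau)\,\mathrm{d}\tau$: the map $t\mapsto z(\theta_t\omega)$ is continuous, $z(\theta_t\omega)/t\to0$ and $\frac1t\int_0^tz(\theta_\tau\omega)\,\mathrm{d}\tau\to0$ as $t\to\pm\infty$. **Equation.** $H$ is a separable Hilbert space with norm $|\cdot|$. $F:H\to H$ is globally Lipschitz with Lipschitz constant $\mathrm{Lip}F$, and $G(\omega,u)=e^{-z(\omega)}F(e^{z(\omega)}u)$, so $G(\omega,\cdot)$ has Lipschitz constant $\mathrm{Lip}F$. $A:D(A)\to H$ generates a strongly continuous semigroup $e^{At}$ on $H$ satisfying the pseudo exponential dichotomy condition with exponents $0>\alpha>\beta$ and bound $K>0$: there is a continuous projection $P$ on $H$, with $Q=I-P$, such that (i) $Pe^{At}=e^{At}P$; (ii) for $t\ge0$ the restriction of $e^{At}$ to $PH$ is an isomorphism of $PH$ onto itself, and $e^{At}$ for $t<0$ denotes the inverse map of $e^{A(-t)}$ on $PH$;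 (iii) $|e^{At}Px|\le Ke^{\alpha t}|x|$ for $t\le0$ and $|e^{At}Qx|\le Ke^{\beta t}|x|$ for $t\ge0$, for all $x\in H$. Solutions are understood in the mild sense, i.e. $$u(t)=e^{At+\int_0^tz(\theta_r\omega)\mathrm{d}r}x+\int_0^te^{A(t-s)+\int_s^tz(\theta_r\omega)\mathrm{d}r}G(\theta_s\omega,u(s))\,\mathrm{d}s .$$ The equation generates a random dynamical system $\varphi:\mathbb R^+\times\Omega\times H\to H$, $\varphi(t,\omega,x)=$ the solution at time $t$ starting from $x$ at time $0$; it satisfies $\varphi(0,\omega,\cdot)=\mathrm{id}$ and $\varphi(t+s,\omega,\cdot)=\varphi(t,\theta_s\omega,\varphi(s,\omega,\cdot))$. **The manifold.** A random set $M(\omega)$ is invariant if $\varphi(t,\omega,M(\omega))\subset M(\theta_t\omega)$ for all $t\ge0$; a Lipschitz invariant manifold is an invariant set of the form $\{\xi+h(\xi,\omega)\mid\xi\in PH\}$ with $h(\cdot,\omega):PH\to QH$ Lipschitz. By a known result, if $K\,\mathrm{Lip}F\left(\frac1{\alpha-\eta}+\frac1{\eta-\beta}\right)<1$ (which is implied by the gap condition in the claim), then for each $\xi\in PH$ and $\omega\in\Omega$ there is a unique continuous $u(\cdot)=u(\cdot;\xi,\omega):(-\infty,0]\to H$ with $\sup_{t\le0}e^{-\eta t-\int_0^tz(\theta_r\omega)\mathrm{d}r}|u(t)|<\infty$ and, for $t\le 0$, $$u(t)=e^{At+\int_0^tz(\theta_r\omega)\mathrm{d}r}\xi+\int_0^te^{A(t-s)+\int_s^tz(\theta_r\omega)\mathrm{d}r}PG(\theta_s\omega,u(s))\,\mathrm{d}s+\int_{-\infty}^te^{A(t-s)+\int_s^tz(\theta_r\omega)\mathrm{d}r}QG(\theta_s\omega,u(s))\,\mathrm{d}s,$$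 and, with $$h(\xi,\omega)=\int_{-\infty}^0e^{-As+\int_s^0z(\theta_r\omega)\mathrm{d}r}QG(\theta_s\omega,u(s;\xi,\omega))\,\mathrm{d}s,$$ the set $M(\omega)=\{\xi+h(\xi,\omega)\mid\xi\in PH\}$ is a Lipschitz invariant manifold for the equation. $\mathrm{Lip}h$ denotes the Lipschitz constant of $h(\cdot,\omega):PH\to QH$ (uniform in $\omega$). *)

theory Defs
  imports "HOL-Probability.Probability"
begin

section \<open>The canonical Wiener space and the stationary Ornstein--Uhlenbeck process\<close>

definition C0_paths :: "(real \<Rightarrow> real) set" where
  "C0_paths = {\<omega>. continuous_on UNIV \<omega> \<and> \<omega> 0 = 0}"

definition theta :: "real \<Rightarrow> (real \<Rightarrow> real) \<Rightarrow> real \<Rightarrow> real" where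
  "theta t \<omega> = (\<lambda>s. \<omega> (t + s) - \<omega> t)"

text \<open>The sigma-algebra is the one generated by the evaluations on the space of paths, i.e. the
  trace of the product sigma-algebra. It is the Borel sigma-algebra of locally uniform convergence.\<close>

definition wiener_measure :: "(real \<Rightarrow> real) measure \<Rightarrow> bool" where
  "wiener_measure W \<longleftrightarrow>
     prob_space W \<and>
     sets W = sets (restrict_space (Pi\<^sub>M UNIV (\<lambda>_::real. (borel :: real measure))) C0_paths) \<and>
     (\<forall>s t. s < t \<longrightarrow>
        distributed W lborel (\<lambda>\<omega>. \<omega> t - \<omega> s) (\<lambda>x. ennreal (normal_density 0 (sqrt (t - s)) x))) \<and>
     (\<forall>(n::nat) \<tau>::nat \<Rightarrow> real. strict_mono_on {..n} \<tau> \<longrightarrow>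
        prob_space.indep_vars W (\<lambda>_. borel) (\<lambda>i \<omega>. \<omega> (\<tau> (Suc i)) - \<omega> (\<tau> i)) {..<n})"

definition ou :: "(real \<Rightarrow> real) \<Rightarrow> real" where
  "ou \<omega> = - (LBINT \<tau>=-\<infinity>..0. exp \<tau> * \<omega> \<tau>)"

definition ou_int :: "(real \<Rightarrow> real) \<Rightarrow> real \<Rightarrow> real \<Rightarrow> real" where
  "ou_int \<omega> s t = (LBINT r=ereal s..ereal t. ou (theta r \<omega>))"

text \<open>Full measure is expressed by \<open>AE\<close>, so that the set need only be measurable with
  respect to the completion of the Wiener measure.\<close>

definition noise_space :: "(real \<Rightarrow> real) measure \<Rightarrow> (real \<Rightarrow> real) set \<Rightarrow> bool" where
  "noise_space W \<Omega> \<longleftrightarrow>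
     wiener_measure W \<and>
     \<Omega> \<subseteq> C0_paths \<and>
     (AE \<omega> in W. \<omega> \<in> \<Omega>) \<and>
     (\<forall>t. \<forall>\<omega>\<in>\<Omega>. theta t \<omega> \<in> \<Omega>) \<and>
     (\<forall>\<omega>\<in>\<Omega>.
        ((\<lambda>t. \<omega> t / t) \<longlongrightarrow> 0) at_top \<and> ((\<lambda>t. \<omega> t / t) \<longlongrightarrow> 0) at_bot \<and>
        continuous_on UNIV (\<lambda>t. ou (theta t \<omega>)) \<and>
        ((\<lambda>t. ou (theta t \<omega>) / t) \<longlongrightarrow> 0) at_top \<and>
        ((\<lambda>t. ou (theta t \<omega>) / t) \<longlongrightarrow> 0) at_bot \<and>
        ((\<lambda>t. (1 / t) * ou_int \<omega> 0 t) \<longlongrightarrow> 0) at_top \<and>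
        ((\<lambda>t. (1 / t) * ou_int \<omega> 0 t) \<longlongrightarrow> 0) at_bot)"


section \<open>Strongly continuous semigroups and the pseudo exponential dichotomy\<close>

text \<open>Only the values \<open>S t\<close> with \<open>t \<ge> 0\<close> are meaningful.\<close>

definition C0_semigroup :: "(real \<Rightarrow> 'a::real_normed_vector \<Rightarrow>\<^sub>L 'a) \<Rightarrow> bool" where
  "C0_semigroup S \<longleftrightarrow>
     S 0 = id_blinfun \<and>
     (\<forall>s\<ge>0. \<forall>t\<ge>0. S (s + t) = S s o\<^sub>L S t) \<and>
     (\<forall>x. ((\<lambda>t. S t x) \<longlongrightarrow> x) (at_right 0))"

definition generates ::
  "('a \<Rightarrow> 'a) \<Rightarrow> 'a set \<Rightarrow> (real \<Rightarrow> 'a::real_normed_vector \<Rightarrow>\<^sub>L 'a) \<Rightarrow> bool" where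
  "generates A D S \<longleftrightarrow>
     C0_semigroup S \<and>
     D = {x. \<exists>y. ((\<lambda>t. (S t x - x) /\<^sub>R t) \<longlongrightarrow> y) (at_right 0)} \<and>
     (\<forall>x\<in>D. ((\<lambda>t. (S t x - x) /\<^sub>R t) \<longlongrightarrow> A x) (at_right 0))"

text \<open>For negative \<open>t\<close> this is the inverse of \<open>S (-t)\<close> restricted to the range of \<open>P\<close>;
  it is then meaningful only on that range.\<close>

definition expA ::
  "(real \<Rightarrow> 'a::real_normed_vector \<Rightarrow>\<^sub>L 'a) \<Rightarrow> ('a \<Rightarrow>\<^sub>L 'a) \<Rightarrow> real \<Rightarrow> 'a \<Rightarrow> 'a" where
  "expA S P t x = (if t \<ge> 0 then S t x else the_inv_into (range P) (S (- t)) x)"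

text \<open>The continuity of the inverse of \<open>S t\<close> on the range of \<open>P\<close>, part of the requirement
  that the restriction be an isomorphism, is contained in the first of the two exponential
  bounds.\<close>

definition pseudo_exp_dichotomy ::
  "(real \<Rightarrow> 'a::real_normed_vector \<Rightarrow>\<^sub>L 'a) \<Rightarrow> ('a \<Rightarrow>\<^sub>L 'a) \<Rightarrow> real \<Rightarrow> real \<Rightarrow> real \<Rightarrow> bool" where
  "pseudo_exp_dichotomy S P \<alpha> \<beta> K \<longleftrightarrow>
     0 > \<alpha> \<and> \<alpha> > \<beta> \<and> K > 0 \<and>
     P o\<^sub>L P = P \<and>
     (\<forall>t\<ge>0. P o\<^sub>L S t = S t o\<^sub>L P) \<and>
     (\<forall>t\<ge>0. bij_betw (S t) (range P) (range P)) \<and>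
     (\<forall>t\<le>0. \<forall>x. norm (expA S P t (P x)) \<le> K * exp (\<alpha> * t) * norm x) \<and>
     (\<forall>t\<ge>0. \<forall>x. norm (expA S P t (x - P x)) \<le> K * exp (\<beta> * t) * norm x)"


section \<open>The random evolution equation\<close>

definition G_of :: "('a::real_normed_vector \<Rightarrow> 'a) \<Rightarrow> (real \<Rightarrow> real) \<Rightarrow> 'a \<Rightarrow> 'a" where
  "G_of F \<omega> u = exp (- ou \<omega>) *\<^sub>R F (exp (ou \<omega>) *\<^sub>R u)"

text \<open>The integrals below are Bochner integrals over oriented intervals.\<close>

definition mild_solution ::
  "(real \<Rightarrow> 'a::{banach, second_countable_topology} \<Rightarrow>\<^sub>L 'a) \<Rightarrow> ('a \<Rightarrow> 'a) \<Rightarrow>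
   (real \<Rightarrow> real) \<Rightarrow> 'a \<Rightarrow> (real \<Rightarrow> 'a) \<Rightarrow> bool" where
  "mild_solution S F \<omega> x u \<longleftrightarrow>
     continuous_on {0..} u \<and>
     (\<forall>t\<ge>0. u t = exp (ou_int \<omega> 0 t) *\<^sub>R S t x +
        (LBINT s=0..ereal t. exp (ou_int \<omega> s t) *\<^sub>R S (t - s) (G_of F (theta s \<omega>) (u s))))"


section \<open>The Lipschitz invariant manifold\<close>

definition backward_solution ::
  "(real \<Rightarrow> 'a::{banach, second_countable_topology} \<Rightarrow>\<^sub>L 'a) \<Rightarrow> ('a \<Rightarrow>\<^sub>L 'a) \<Rightarrow> ('a \<Rightarrow> 'a) \<Rightarrow>
   real \<Rightarrow> (real \<Rightarrow> real) \<Rightarrow> 'a \<Rightarrow> (real \<Rightarrow> 'a) \<Rightarrow> bool" where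
  "backward_solution S P F \<eta> \<omega> \<xi> u \<longleftrightarrow>
     continuous_on {..0} u \<and>
     bdd_above ((\<lambda>t. exp (- \<eta> * t - ou_int \<omega> 0 t) * norm (u t)) ` {..0}) \<and>
     (\<forall>t\<le>0. u t =
        exp (ou_int \<omega> 0 t) *\<^sub>R expA S P t \<xi> +
        (LBINT s=0..ereal t.
           exp (ou_int \<omega> s t) *\<^sub>R expA S P (t - s) (P (G_of F (theta s \<omega>) (u s)))) +
        (LBINT s=-\<infinity>..ereal t.
           exp (ou_int \<omega> s t) *\<^sub>R
             expA S P (t - s) (G_of F (theta s \<omega>) (u s) - P (G_of F (theta s \<omega>) (u s)))))"

text \<open>A backward solution is unique only up to its irrelevant values on the positive half-line,
  hence the choice by \<open>SOME\<close> rather than \<open>THE\<close>.\<close>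

definition backward_sol ::
  "(real \<Rightarrow> 'a::{banach, second_countable_topology} \<Rightarrow>\<^sub>L 'a) \<Rightarrow> ('a \<Rightarrow>\<^sub>L 'a) \<Rightarrow> ('a \<Rightarrow> 'a) \<Rightarrow>
   real \<Rightarrow> (real \<Rightarrow> real) \<Rightarrow> 'a \<Rightarrow> real \<Rightarrow> 'a" where
  "backward_sol S P F \<eta> \<omega> \<xi> = (SOME u. backward_solution S P F \<eta> \<omega> \<xi> u)"

definition graph_map ::
  "(real \<Rightarrow> 'a::{banach, second_countable_topology} \<Rightarrow>\<^sub>L 'a) \<Rightarrow> ('a \<Rightarrow>\<^sub>L 'a) \<Rightarrow> ('a \<Rightarrow> 'a) \<Rightarrow>
   real \<Rightarrow> (real \<Rightarrow> real) \<Rightarrow> 'a \<Rightarrow> 'a" where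
  "graph_map S P F \<eta> \<omega> \<xi> =
     (LBINT s=-\<infinity>..0.
        (let g = G_of F (theta s \<omega>) (backward_sol S P F \<eta> \<omega> \<xi> s)
         in exp (ou_int \<omega> s 0) *\<^sub>R expA S P (- s) (g - P g)))"

definition inv_manifold ::
  "(real \<Rightarrow> 'a::{banach, second_countable_topology} \<Rightarrow>\<^sub>L 'a) \<Rightarrow> ('a \<Rightarrow>\<^sub>L 'a) \<Rightarrow> ('a \<Rightarrow> 'a) \<Rightarrow>
   real \<Rightarrow> (real \<Rightarrow> real) \<Rightarrow> 'a set" where
  "inv_manifold S P F \<eta> \<omega> = {\<xi> + graph_map S P F \<eta> \<omega> \<xi> | \<xi>. \<xi> \<in> range P}"

end

theory Submission
  imports Defs
begin

text \<open>The factor \<open>exp (ou_int \<omega> s t)\<close> of the evolution is the quotient of \<open>exp (Z t)\<close> and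
  \<open>exp (Z s)\<close> with \<open>Z t = ou_int \<omega> 0 t\<close>. Hence \<open>exp (- Z t) u t\<close> is a mild solution of a
  deterministic, non-autonomous equation \<open>v' = A v + g t v\<close>, and \<open>g t\<close> has the same
  Lipschitz constant as \<open>F\<close> because the scaling by \<open>exp (- Z t)\<close> cancels (lemmas
  \<open>mild_solution_iff\<close> and \<open>norm_noiseless_G_diff\<close>).

  For the deterministic equation a given solution \<open>u\<close> is shadowed by one starting on the graph of
  \<open>h\<close> (lemma \<open>shadowing_solution\<close>). A difference \<open>w = v - u\<close> is sought among the functions
  of size \<open>O(exp (\<eta> t))\<close>. With \<open>f s = g s (u s + w s) - g s (u s)\<close>, boundedness in this
  weight forces the \<open>P\<close>-part of \<open>w 0\<close> to be minus the integral \<open>I\<close> of the backward flow of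
  \<open>P f\<close> over the half-line, and the condition that \<open>v 0\<close> lies on the graph then determines
  the complementary part through \<open>h\<close>. The variation of constants formula with this initial
  value is a contraction: the two halves of the dichotomy contribute
  \<open>K L (1 / (\<alpha> - \<eta>) + 1 / (\<eta> - \<beta>))\<close> (lemma \<open>norm_conv_minus_unstable\<close>), and the
  dependence of the initial value on \<open>I\<close> contributes \<open>K\<^sup>2 Lh L / (\<alpha> - \<eta>)\<close>; the gap
  condition says that these add up to less than one.

  The shadowing solution is \<open>exp (- Z t)\<close> times the flow through its initial point, since mild
  solutions are unique (lemma \<open>mild_unique\<close>). Returning to the original equation multiplies the
  distance \<open>O(exp (\<eta> t))\<close> by \<open>exp (Z t)\<close>, which grows slower than any exponential (lemma
  \<open>ou_int_sublinear\<close>). Since \<open>\<eta> < 0\<close>, half of the rate survives, so that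
  \<open>c\<^sub>2 = - \<eta> / 2\<close> serves for all \<open>\<omega>\<close>. The argument sees the
  manifold only through a Lipschitz map with values in the kernel of \<open>P\<close> (lemma
  \<open>P_graph_map\<close>).\<close>

section \<open>Integration of continuous functions on half-lines\<close>

lemma continuous_on_atLeast_from_Icc:
  fixes f :: "real \<Rightarrow> 'b::topological_space"
  assumes "\<And>N. continuous_on {a..N} f"
  shows "continuous_on {a..} f"
proof (rule continuous_on_sequentiallyI)
  fix x :: "nat \<Rightarrow> real" and l assume x: "\<forall>n. x n \<in> {a..}" "l \<in> {a..}" "x \<longlonglongrightarrow> l"
  obtain N where N: "\<And>n. norm (x n) \<le> N"
    using convergent_imp_Bseq[OF convergentI[OF x(3)]] by (auto simp: Bseq_def)
  have "x n \<in> {a..max N l}" for n using x(1) N[of n] by (auto simp: abs_le_iff le_max_iff_disj)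
  moreover have "l \<in> {a..max N l}" using x(2) by auto
  ultimately show "(\<lambda>n. f (x n)) \<longlonglongrightarrow> f l"
    using assms[of "max N l"] x(3) unfolding continuous_on_sequentially comp_def by blast
qed

lemma set_integrable_continuous_Icc:
  fixes f :: "real \<Rightarrow> 'b::{banach, second_countable_topology}"
  assumes "continuous_on {a..b} f"
  shows "set_integrable lborel {a..b} f"
  unfolding set_integrable_def by (rule borel_integrable_compact) (use assms in auto)

lemma set_integrable_exp_atLeast:
  fixes c :: real
  assumes "c > 0"
  shows "set_integrable lborel {a..} (\<lambda>s. exp (- c * s))"
    and "(LINT s:{a..}|lborel. exp (- c * s)) = exp (- c * a) / c"
proof -
  have lim: "((\<lambda>s. - exp (- c * s) / c) \<longlongrightarrow> 0) at_top"
  proof -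
    have "filterlim (\<lambda>s. - c * s) at_bot at_top"
      by (rule filterlim_tendsto_neg_mult_at_bot[OF tendsto_const _ filterlim_ident])
         (use assms in simp)
    then have "((\<lambda>s. exp (- c * s)) \<longlongrightarrow> 0) at_top"
      by (rule filterlim_compose[OF exp_at_bot])
    then have "((\<lambda>s. - exp (- c * s) / c) \<longlongrightarrow> - 0 / c) at_top"
      by (intro tendsto_intros) (use assms in auto)
    then show ?thesis by simp
  qed
  have "(\<integral>\<^sup>+s. ennreal (exp (- c * s)) * indicator {a..} s \<partial>lborel) = ennreal (0 - (- exp (- c * a) / c))"
    by (rule nn_integral_FTC_atLeast[OF _ _ _ lim])
       (use assms in \<open>auto intro!: derivative_eq_intros\<close>)
  also have "(\<integral>\<^sup>+s. ennreal (exp (- c * s)) * indicator {a..} s \<partial>lborel)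
      = (\<integral>\<^sup>+s. ennreal (indicator {a..} s *\<^sub>R exp (- c * s)) \<partial>lborel)"
    by (intro nn_integral_cong) (auto split: split_indicator)
  finally have nn: "(\<integral>\<^sup>+s. ennreal (indicator {a..} s *\<^sub>R exp (- c * s)) \<partial>lborel)
      = ennreal (exp (- c * a) / c)" by simp
  have "has_bochner_integral lborel (\<lambda>s. indicator {a..} s *\<^sub>R exp (- c * s)) (exp (- c * a) / c)"
    by (rule has_bochner_integral_nn_integral[OF _ _ _ nn]) (use assms in auto)
  then show "set_integrable lborel {a..} (\<lambda>s. exp (- c * s))"
      "(LINT s:{a..}|lborel. exp (- c * s)) = exp (- c * a) / c"
    by (auto simp: set_integrable_def set_lebesgue_integral_def has_bochner_integral_iff)
qed

lemma set_integral_exp_Icc_le: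
  fixes c t :: real
  assumes "c > 0" "t \<ge> 0"
  shows "(LINT s:{0..t}|lborel. exp (c * s)) \<le> exp (c * t) / c"
proof -
  have "(LINT s:{0..t}|lborel. exp (c * s)) = exp (c * t) / c - exp (c * 0) / c"
    unfolding set_lebesgue_integral_def using assms
    by (intro integral_FTC_atLeastAtMost)
       (auto intro!: derivative_eq_intros continuous_intros
             simp: has_real_derivative_iff_has_vector_derivative[symmetric])
  also have "\<dots> \<le> exp (c * t) / c" using assms by simp
  finally show ?thesis .
qed

lemma set_integrable_dominated_continuous:
  fixes f :: "real \<Rightarrow> 'b::{banach, second_countable_topology}"
  assumes "set_integrable lborel A w" "continuous_on A f" "A \<in> sets borel"
    and "\<And>s. s \<in> A \<Longrightarrow> norm (f s) \<le> (w s :: real)"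
  shows "set_integrable lborel A f"
proof (rule set_integrable_bound[OF assms(1)])
  show "set_borel_measurable lborel A f"
    unfolding set_borel_measurable_def using assms borel_measurable_continuous_on_indicator by simp
  show "AE x in lborel. x \<in> A \<longrightarrow> norm (f x) \<le> norm (w x)"
    using assms(4) by (auto simp: abs_if intro!: AE_I2) (smt (verit))
qed

lemma norm_set_integral_le:
  fixes f :: "real \<Rightarrow> 'b::{banach, second_countable_topology}"
  assumes "set_integrable lborel A f" "set_integrable lborel A w"
    and "\<And>s. s \<in> A \<Longrightarrow> norm (f s) \<le> (w s :: real)"
  shows "norm (LINT s:A|lborel. f s) \<le> (LINT s:A|lborel. w s)"
proof -
  have "norm (LINT s:A|lborel. f s) \<le> (LINT s:A|lborel. norm (f s))"
    by (rule set_integral_norm_bound[OF assms(1)])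
  also have "\<dots> \<le> (LINT s:A|lborel. w s)"
    by (rule set_integral_mono) (use assms in \<open>auto intro: set_integrable_norm\<close>)
  finally show ?thesis .
qed

lemma set_integral_blinfun:
  fixes f :: "real \<Rightarrow> 'b::{banach, second_countable_topology}"
    and T :: "'b \<Rightarrow>\<^sub>L 'c::{banach, second_countable_topology}"
  assumes "set_integrable lborel A f"
  shows "set_integrable lborel A (\<lambda>s. T (f s))"
    and "(LINT s:A|lborel. T (f s)) = T (LINT s:A|lborel. f s)"
  using integrable_bounded_linear[OF blinfun.bounded_linear_right[of T] assms[unfolded set_integrable_def]]
    integral_bounded_linear[OF blinfun.bounded_linear_right[of T] assms[unfolded set_integrable_def]]
  unfolding set_integrable_def set_lebesgue_integral_def by (simp_all add: blinfun.scaleR_right)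

section \<open>Semigroups with a pseudo exponential dichotomy\<close>

locale dichotomous_semigroup =
  fixes S :: "real \<Rightarrow> 'a::{banach, second_countable_topology} \<Rightarrow>\<^sub>L 'a"
    and P :: "'a \<Rightarrow>\<^sub>L 'a" and \<alpha> \<beta> K :: real
  assumes semigroup: "C0_semigroup S"
    and dichotomy: "pseudo_exp_dichotomy S P \<alpha> \<beta> K"
begin

lemma S_0: "S 0 x = x"
  using semigroup by (simp add: C0_semigroup_def)

lemma S_add: "s \<ge> 0 \<Longrightarrow> t \<ge> 0 \<Longrightarrow> S (s + t) x = S s (S t x)"
  using semigroup by (simp add: C0_semigroup_def)

lemma P_idem: "P (P x) = P x"
  using dichotomy unfolding pseudo_exp_dichotomy_def by (metis blinfun_apply_blinfun_compose)

lemma P_S: "t \<ge> 0 \<Longrightarrow> P (S t x) = S t (P x)"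
  using dichotomy unfolding pseudo_exp_dichotomy_def by (metis blinfun_apply_blinfun_compose)

lemma K_pos: "K > 0" and \<alpha>_neg: "\<alpha> < 0" and \<beta>_less: "\<beta> < \<alpha>"
  using dichotomy unfolding pseudo_exp_dichotomy_def by auto

lemma bij_S: "t \<ge> 0 \<Longrightarrow> bij_betw (S t) (range P) (range P)"
  using dichotomy unfolding pseudo_exp_dichotomy_def by auto

lemma norm_S_complement: "t \<ge> 0 \<Longrightarrow> norm (S t (x - P x)) \<le> K * exp (\<beta> * t) * norm x"
  using dichotomy unfolding pseudo_exp_dichotomy_def expA_def by auto

text \<open>The flow \<open>exp (- s A) P\<close> backward in time on the range of \<open>P\<close>, for \<open>s \<ge> 0\<close>.\<close>
definition bwd :: "real \<Rightarrow> 'a \<Rightarrow> 'a" where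
  "bwd s y = expA S P (- s) (P y)"

lemma norm_bwd: "s \<ge> 0 \<Longrightarrow> norm (bwd s y) \<le> K * exp (- \<alpha> * s) * norm y"
  using dichotomy unfolding pseudo_exp_dichotomy_def bwd_def
  by (metis (no_types, opaque_lifting) mult_minus_left mult_minus_right neg_le_0_iff_le)

lemma
  assumes "s \<ge> 0"
  shows S_bwd: "S s (bwd s y) = P y" and bwd_range: "bwd s y \<in> range P"
proof -
  have "S s (bwd s y) = P y \<and> bwd s y \<in> range P"
  proof (cases "s = 0")
    case True then show ?thesis by (simp add: bwd_def expA_def S_0)
  next
    case False
    then have *: "bwd s y = the_inv_into (range P) (S s) (P y)" using assms by (simp add: bwd_def expA_def)
    show ?thesis unfolding * using bij_S[OF assms]
      by (metis f_the_inv_into_f_bij_betw bij_betw_def rangeI the_inv_into_into subset_refl)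
  qed
  then show "S s (bwd s y) = P y" "bwd s y \<in> range P" by auto
qed

lemma P_bwd: "s \<ge> 0 \<Longrightarrow> P (bwd s y) = bwd s y"
  using bwd_range[of s y] P_idem by auto

text \<open>As \<open>S s\<close> is injective on the range of \<open>P\<close>, an identity about \<open>bwd\<close> can be checked after
  applying \<open>S s\<close>; the composition rules and the linearity below are obtained in this way.\<close>
lemma bwd_unique:
  assumes "s \<ge> 0" "v \<in> range P" "S s v = P y"
  shows "v = bwd s y"
  by (rule inj_onD[OF bij_betw_imp_inj_on[OF bij_S[OF assms(1)]]])
     (use assms S_bwd bwd_range in auto)

lemma S_range: "t \<ge> 0 \<Longrightarrow> v \<in> range P \<Longrightarrow> S t v \<in> range P"
  by (metis P_S rangeE rangeI)

lemma S_bwd_ge: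
  assumes "0 \<le> t" "t \<le> s"
  shows "S t (bwd s y) = bwd (s - t) y"
proof (rule bwd_unique)
  show "S (s - t) (S t (bwd s y)) = P y"
    using assms by (simp add: S_add[symmetric] S_bwd)
qed (use assms bwd_range S_range in auto)

lemma S_bwd_le:
  assumes "0 \<le> s" "s \<le> t"
  shows "S t (bwd s y) = S (t - s) (P y)"
  using S_add[of "t - s" s "bwd s y"] assms S_bwd[of s y] by simp

lemma bounded_linear_bwd:
  assumes "s \<ge> 0"
  shows "bounded_linear (bwd s)"
proof (rule bounded_linear_intro)
  show "bwd s (x + y) = bwd s x + bwd s y" for x y
    using assms bwd_range[OF assms]
    by (intro bwd_unique[symmetric]) (auto simp: S_bwd blinfun.add_right,
        metis P_bwd blinfun.add_right rangeI)
  show "bwd s (r *\<^sub>R x) = r *\<^sub>R bwd s x" for r x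
    using assms bwd_range[OF assms]
    by (intro bwd_unique[symmetric]) (auto simp: S_bwd blinfun.scaleR_right,
        metis P_bwd blinfun.scaleR_right rangeI)
  show "norm (bwd s x) \<le> norm x * (K * exp (- \<alpha> * s))" for x
    using norm_bwd[OF assms, of x] by (simp add: mult_ac)
qed

text \<open>On the kernel of \<open>P\<close> the dichotomy bounds \<open>S t\<close> directly. On the range of \<open>P\<close> one runs
  the flow forward to time \<open>N\<close> with the single operator \<open>S N\<close> and comes back to time \<open>t\<close>
  with the bounded backward flow.\<close>
lemma S_locally_bounded:
  obtains M where "M > 0" "\<And>t x. 0 \<le> t \<Longrightarrow> t \<le> N \<Longrightarrow> norm (S t x) \<le> M * norm x"
proof (cases "N < 0")
  case True then show ?thesis using that[of 1] by auto
next
  case False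
  define M where "M = K * exp (- \<alpha> * N) * (norm (S N) * norm P) + K"
  have "norm (S t x) \<le> M * norm x" if t: "0 \<le> t" "t \<le> N" for t x
  proof -
    have "S t (P x) = bwd (N - t) (S N x)"
      by (rule bwd_unique) (use t in \<open>auto simp: S_add[symmetric] P_S S_range\<close>)
    then have "norm (S t (P x)) \<le> K * exp (- \<alpha> * (N - t)) * norm (S N (P x))"
      using norm_bwd[of "N - t" "S N (P x)"] t S_bwd_ge bwd_def P_S P_idem
      by (metis diff_ge_0_iff_ge order_trans)
    also have "\<dots> \<le> K * exp (- \<alpha> * N) * (norm (S N) * norm P * norm x)"
    proof (intro mult_mono)
      show "norm (S N (P x)) \<le> norm (S N) * norm P * norm x"
        by (metis (no_types, opaque_lifting) mult.assoc mult_left_mono norm_blinfun norm_ge_zero order_trans)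
      have "- \<alpha> * (N - t) \<le> - \<alpha> * N" using \<alpha>_neg t by (intro mult_left_mono) auto
      then show "exp (- \<alpha> * (N - t)) \<le> exp (- \<alpha> * N)" by simp
    qed (use K_pos in auto)
    finally have 1: "norm (S t (P x)) \<le> K * exp (- \<alpha> * N) * (norm (S N) * norm P * norm x)" .
    have "norm (S t (x - P x)) \<le> K * exp (\<beta> * t) * norm x"
      by (rule norm_S_complement) (use t in auto)
    also have "\<dots> \<le> K * 1 * norm x"
      using \<alpha>_neg \<beta>_less t K_pos by (intro mult_right_mono mult_left_mono) (auto simp: mult_nonpos_nonneg)
    finally have 2: "norm (S t (x - P x)) \<le> K * norm x" by simp
    have "S t x = S t (P x) + S t (x - P x)" by (simp add: blinfun.diff_right)
    then have "norm (S t x) \<le> norm (S t (P x)) + norm (S t (x - P x))" by (metis norm_triangle_ineq)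
    then show ?thesis using 1 2 by (simp add: M_def algebra_simps)
  qed
  moreover have "M > 0" unfolding M_def using K_pos by (intro add_nonneg_pos) auto
  ultimately show ?thesis using that by blast
qed

text \<open>Strong continuity is given at 0 only. The difference of two points of an orbit is the image
  of a difference at 0 under the operator of the earlier time, so the local bound carries continuity
  to both sides of every point.\<close>
lemma continuous_on_orbit: "continuous_on {0..} (\<lambda>t. S t x)"
proof (rule continuous_on_atLeast_from_Icc)
  fix N :: real
  obtain M where M: "M > 0" "\<And>t x. 0 \<le> t \<Longrightarrow> t \<le> N \<Longrightarrow> norm (S t x) \<le> M * norm x"
    using S_locally_bounded[of N] by blast
  have est: "norm (S t x - S s x) \<le> M * norm (S (t - s) x - x)"
    if "0 \<le> s" "s \<le> t" "t \<le> N" for s t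
  proof -
    have "S t x - S s x = S s (S (t - s) x - x)"
      using that S_add[of s "t - s" x] by (simp add: blinfun.diff_right)
    then show ?thesis using M(2)[of s] that by simp
  qed
  have lim: "((\<lambda>t. S t x) \<longlongrightarrow> x) (at_right 0)"
    using semigroup by (simp add: C0_semigroup_def)
  show "continuous_on {0..N} (\<lambda>t. S t x)"
  proof (rule continuous_on_iff[THEN iffD2], intro ballI allI impI)
    fix t e :: real assume t: "t \<in> {0..N}" and e: "e > 0"
    have "eventually (\<lambda>r. dist (S r x) x < e / M) (at_right 0)"
      using lim e M(1) by (intro tendstoD) auto
    then obtain d where d: "d > 0" "\<And>r. 0 < r \<Longrightarrow> r < d \<Longrightarrow> dist (S r x) x < e / M"
      by (auto simp: eventually_at_right_field)
    have d': "norm (S r x - x) < e / M" if "0 \<le> r" "r < d" for r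
      using d(2)[of r] that e M(1) by (cases "r = 0") (auto simp: S_0 dist_norm)
    have "dist (S s x) (S t x) < e" if s: "s \<in> {0..N}" "dist s t < d" for s
    proof (cases "s \<le> t")
      case True
      have "norm (S t x - S s x) \<le> M * norm (S (t - s) x - x)" using est True s t by auto
      also have "\<dots> < M * (e / M)" using d'[of "t - s"] True s M(1)
        by (intro mult_strict_left_mono) (auto simp: dist_real_def)
      finally show ?thesis using M(1) by (simp add: dist_norm norm_minus_commute)
    next
      case False
      have "norm (S s x - S t x) \<le> M * norm (S (s - t) x - x)" using est False s t by auto
      also have "\<dots> < M * (e / M)" using d'[of "s - t"] False s M(1)
        by (intro mult_strict_left_mono) (auto simp: dist_real_def)
      finally show ?thesis using M(1) by (simp add: dist_norm)
    qed
    then show "\<exists>d>0. \<forall>x'\<in>{0..N}. dist x' t < d \<longrightarrow> dist (S x' x) (S t x) < e"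
      using d(1) by blast
  qed
qed

text \<open>Joint continuity follows from strong continuity and local boundedness.\<close>
lemma tendsto_S:
  assumes t: "\<And>n. t n \<ge> (0::real)" "t \<longlonglongrightarrow> l" and x: "x \<longlonglongrightarrow> y"
  shows "(\<lambda>n. S (t n) (x n)) \<longlonglongrightarrow> S l y"
proof -
  have l: "l \<ge> 0" using LIMSEQ_le_const[OF t(2)] t(1) by auto
  obtain N where N: "\<And>n. norm (t n) \<le> N"
    using convergent_imp_Bseq[OF convergentI[OF t(2)]] by (auto simp: Bseq_def)
  obtain M where M: "\<And>t x. 0 \<le> t \<Longrightarrow> t \<le> N \<Longrightarrow> norm (S t x) \<le> M * norm x"
    using S_locally_bounded[of N] by blast
  have "(\<lambda>n. M * norm (x n - y)) \<longlonglongrightarrow> M * norm (y - y)" by (intro tendsto_intros x)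
  then have *: "(\<lambda>n. M * norm (x n - y)) \<longlonglongrightarrow> 0" by simp
  have "(\<lambda>n. S (t n) (x n - y)) \<longlonglongrightarrow> 0"
    by (rule Lim_null_comparison[OF _ *])
       (use M t(1) N in \<open>auto intro!: always_eventually simp: abs_le_iff\<close>)
  moreover have "(\<lambda>n. S (t n) y) \<longlonglongrightarrow> S l y"
    using continuous_on_orbit[of y] t l unfolding continuous_on_sequentially comp_def by auto
  ultimately have "(\<lambda>n. S (t n) (x n - y) + S (t n) y) \<longlonglongrightarrow> 0 + S l y" by (rule tendsto_add)
  then show ?thesis by (simp add: blinfun.diff_right)
qed

lemma continuous_on_S:
  fixes r :: "real \<Rightarrow> real" and f :: "real \<Rightarrow> 'a"
  assumes "continuous_on A r" "continuous_on A f" "\<And>s. s \<in> A \<Longrightarrow> r s \<ge> 0"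
  shows "continuous_on A (\<lambda>s. S (r s) (f s))"
proof (rule continuous_on_sequentiallyI)
  fix u :: "nat \<Rightarrow> real" and a assume u: "\<forall>n. u n \<in> A" "a \<in> A" "u \<longlonglongrightarrow> a"
  show "(\<lambda>n. S (r (u n)) (f (u n))) \<longlonglongrightarrow> S (r a) (f a)"
    by (rule tendsto_S) (use assms u in \<open>auto simp: continuous_on_sequentially comp_def\<close>)
qed

text \<open>On \<open>{0..N}\<close> the backward flow is the forward flow applied to the position at time \<open>- N\<close>, so
  its continuity is that of \<open>S\<close>.\<close>
lemma continuous_on_bwd:
  assumes "continuous_on {0..} f"
  shows "continuous_on {0..} (\<lambda>s. bwd s (f s))"
proof (rule continuous_on_atLeast_from_Icc)
  fix N :: real
  show "continuous_on {0..N} (\<lambda>s. bwd s (f s))"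
  proof (cases "N < 0")
    case False
    have "continuous_on {0..N} (\<lambda>s. S (N - s) (bwd N (f s)))"
      using False by (intro continuous_on_S continuous_intros
          bounded_linear.continuous_on[OF bounded_linear_bwd] continuous_on_subset[OF assms]) auto
    then show ?thesis
      by (rule continuous_on_eq) (use S_bwd_ge in auto)
  qed auto
qed

section \<open>Variation of constants in exponentially weighted spaces\<close>

definition conv :: "(real \<Rightarrow> 'a) \<Rightarrow> real \<Rightarrow> 'a" where
  "conv f t = (LINT s:{0..t}|lborel. S (t - s) (f s))"

text \<open>For \<open>f\<close> of size \<open>O(exp (\<eta> t))\<close> with \<open>\<eta> < \<alpha>\<close>, minus this value is the one initial
  \<open>P\<close>-component for which the \<open>P\<close>-part of the solution of \<open>w' = A w + f\<close> is of that size too: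
  any other choice adds an orbit in the range of \<open>P\<close>, which decays no faster than
  \<open>exp (\<alpha> t)\<close>.\<close>
definition unstable_int :: "(real \<Rightarrow> 'a) \<Rightarrow> 'a" where
  "unstable_int f = (LINT s:{0..}|lborel. bwd s (f s))"

lemma conv_integrable:
  assumes "continuous_on {0..} f"
  shows "set_integrable lborel {0..t} (\<lambda>s. S (t - s) (f s))"
  by (intro set_integrable_continuous_Icc continuous_on_S continuous_intros
        continuous_on_subset[OF assms]) auto

text \<open>Both the integrand and the domain of integration vary with \<open>t\<close>; as the indicators of
  \<open>{0..t n}\<close> converge off the single point \<open>l\<close>, dominated convergence applies.\<close>
lemma continuous_on_conv:
  assumes f: "continuous_on {0..} f"
  shows "continuous_on {0..} (conv f)"
proof (rule continuous_on_sequentiallyI)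
  fix t :: "nat \<Rightarrow> real" and l assume t: "\<forall>n. t n \<in> {0..}" "l \<in> {0..}" "t \<longlonglongrightarrow> l"
  obtain N where N: "\<And>n. norm (t n) \<le> N"
    using convergent_imp_Bseq[OF convergentI[OF t(3)]] by (auto simp: Bseq_def)
  obtain M where M: "M > 0" "\<And>t x. 0 \<le> t \<Longrightarrow> t \<le> N \<Longrightarrow> norm (S t x) \<le> M * norm x"
    using S_locally_bounded[of N] by blast
  have "compact (f ` {0..N})"
    by (intro compact_continuous_image continuous_on_subset[OF f]) auto
  then obtain B where B: "\<And>s. s \<in> {0..N} \<Longrightarrow> norm (f s) \<le> B"
    by (meson bounded_iff compact_imp_bounded imageI)
  have meas: "(\<lambda>s. indicator {0..r} s *\<^sub>R S (r - s) (f s)) \<in> borel_measurable lborel" for r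
    using conv_integrable[OF f, of r] by (auto simp: set_integrable_def)
  have int: "integrable lborel (\<lambda>s. indicator {0..N} s *\<^sub>R (M * B))"
    by (rule borel_integrable_compact) auto
  show "(\<lambda>n. conv f (t n)) \<longlonglongrightarrow> conv f l"
    unfolding conv_def set_lebesgue_integral_def
  proof (rule integral_dominated_convergence[OF meas meas int])
    show "AE s in lborel. (\<lambda>n. indicator {0..t n} s *\<^sub>R S (t n - s) (f s))
            \<longlonglongrightarrow> indicator {0..l} s *\<^sub>R S (l - s) (f s)"
      using AE_lborel_singleton[of l]
    proof eventually_elim
      case (elim s)
      consider "s < 0" | "0 \<le> s" "s < l" | "l < s" using elim by linarith
      then show ?case
      proof cases
        case 2
        have "eventually (\<lambda>n. s < t n) sequentially" using t(3) 2 by (auto dest: order_tendstoD)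
        then have ev: "eventually (\<lambda>n. S (max 0 (t n - s)) (f s)
            = indicator {0..t n} s *\<^sub>R S (t n - s) (f s)) sequentially"
          by eventually_elim (use 2 in auto)
        have "(\<lambda>n. S (max 0 (t n - s)) (f s)) \<longlonglongrightarrow> S (max 0 (l - s)) (f s)"
          by (rule tendsto_S) (auto intro!: tendsto_intros t(3))
        then show ?thesis using Lim_transform_eventually[OF _ ev] 2 by auto
      next
        case 3
        have "eventually (\<lambda>n. t n < s) sequentially" using t(3) 3 by (auto dest: order_tendstoD)
        then have ev: "eventually (\<lambda>n. 0 = indicator {0..t n} s *\<^sub>R S (t n - s) (f s)) sequentially"
          by eventually_elim auto
        show ?thesis using Lim_transform_eventually[OF tendsto_const ev] 3 by auto
      qed auto
    qed
    show "AE s in lborel. norm (indicator {0..t n} s *\<^sub>R S (t n - s) (f s))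
            \<le> indicator {0..N} s *\<^sub>R (M * B)" for n
    proof (rule AE_I2)
      fix s :: real
      show "norm (indicator {0..t n} s *\<^sub>R S (t n - s) (f s)) \<le> indicator {0..N} s *\<^sub>R (M * B)"
      proof (cases "s \<in> {0..t n}")
        case True
        then have s: "s \<in> {0..N}" using N[of n] by auto
        have "norm (S (t n - s) (f s)) \<le> M * norm (f s)" using True N[of n] by (intro M) auto
        also have "\<dots> \<le> M * B" using B[OF s] M(1) by simp
        finally show ?thesis using True s by simp
      next
        case False
        have "0 \<le> indicator {0..N} s *\<^sub>R (M * B)"
          using M(1) order_trans[OF norm_ge_zero B, of s] by (auto simp: indicator_def)
        then show ?thesis using False by simp
      qed
    qed
  qed
qed

lemma conv_diff:
  assumes "continuous_on {0..} f" "continuous_on {0..} g"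
  shows "conv (\<lambda>s. f s - g s) t = conv f t - conv g t"
  unfolding conv_def by (simp add: blinfun.diff_right set_integral_diff(2) conv_integrable assms)

lemma norm_bwd_exp:
  assumes "norm y \<le> B * exp (\<eta> * s)" "0 \<le> t" "t \<le> s"
  shows "norm (bwd (s - t) y) \<le> K * B * exp (\<alpha> * t) * exp (- (\<alpha> - \<eta>) * s)"
proof -
  have "norm (bwd (s - t) y) \<le> K * exp (- \<alpha> * (s - t)) * norm y"
    by (rule norm_bwd) (use assms in auto)
  also have "\<dots> \<le> K * exp (- \<alpha> * (s - t)) * (B * exp (\<eta> * s))"
    using K_pos assms by (intro mult_left_mono) auto
  also have "\<dots> = K * B * (exp (- \<alpha> * (s - t)) * exp (\<eta> * s))" by (simp add: mult_ac)
  also have "\<dots> = K * B * (exp (\<alpha> * t) * exp (- (\<alpha> - \<eta>) * s))"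
    by (simp add: exp_add[symmetric] algebra_simps)
  finally show ?thesis by (simp add: mult_ac)
qed

lemma
  assumes f: "continuous_on {0..} f" and \<eta>: "\<eta> < \<alpha>"
    and B: "\<And>s. s \<ge> 0 \<Longrightarrow> norm (f s) \<le> B * exp (\<eta> * s)"
  shows bwd_integrable: "set_integrable lborel {0..} (\<lambda>s. bwd s (f s))"
    and norm_unstable_int: "norm (unstable_int f) \<le> K * B / (\<alpha> - \<eta>)"
proof -
  have le: "norm (bwd s (f s)) \<le> K * B * exp (- (\<alpha> - \<eta>) * s)" if "s \<in> {0..}" for s
    using norm_bwd_exp[of "f s" B \<eta> s 0] B that by auto
  have w: "set_integrable lborel {0..} (\<lambda>s. K * B * exp (- (\<alpha> - \<eta>) * s))"
    using set_integrable_exp_atLeast(1)[of "\<alpha> - \<eta>" 0] \<eta> by (intro set_integrable_mult_right) auto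
  show int: "set_integrable lborel {0..} (\<lambda>s. bwd s (f s))"
    by (rule set_integrable_dominated_continuous[OF w continuous_on_bwd[OF f]]) (use le in auto)
  have "norm (unstable_int f) \<le> (LINT s:{0..}|lborel. K * B * exp (- (\<alpha> - \<eta>) * s))"
    unfolding unstable_int_def by (rule norm_set_integral_le[OF int w le])
  also have "\<dots> = K * B / (\<alpha> - \<eta>)"
    using set_integrable_exp_atLeast(2)[of "\<alpha> - \<eta>" 0] \<eta> by simp
  finally show "norm (unstable_int f) \<le> K * B / (\<alpha> - \<eta>)" .
qed

lemma unstable_int_diff:
  assumes "set_integrable lborel {0..} (\<lambda>s. bwd s (f s))" "set_integrable lborel {0..} (\<lambda>s. bwd s (g s))"
  shows "unstable_int (\<lambda>s. f s - g s) = unstable_int f - unstable_int g"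
proof -
  have "unstable_int (\<lambda>s. f s - g s) = (LINT s:{0..}|lborel. bwd s (f s) - bwd s (g s))"
    unfolding unstable_int_def
    by (rule set_lebesgue_integral_cong) (auto simp: linear_diff[OF bounded_linear.linear[OF bounded_linear_bwd]])
  then show ?thesis unfolding unstable_int_def using assms by (simp add: set_integral_diff(2))
qed

lemma P_unstable_int:
  assumes "set_integrable lborel {0..} (\<lambda>s. bwd s (f s))"
  shows "P (unstable_int f) = unstable_int f"
proof -
  have "P (unstable_int f) = (LINT s:{0..}|lborel. P (bwd s (f s)))"
    unfolding unstable_int_def by (rule set_integral_blinfun(2)[OF assms, symmetric])
  also have "\<dots> = unstable_int f"
    unfolding unstable_int_def by (rule set_lebesgue_integral_cong) (auto simp: P_bwd)
  finally show ?thesis .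
qed

text \<open>Subtracting the orbit of \<open>unstable_int f\<close> replaces the forward integral of \<open>P f\<close> over
  \<open>{0..t}\<close> by a backward integral over \<open>{t<..}\<close>. The left side is visibly continuous in \<open>t\<close>
  and of mild form, the right side is the one that can be estimated.\<close>
lemma conv_minus_unstable:
  assumes f: "continuous_on {0..} f" and int: "set_integrable lborel {0..} (\<lambda>s. bwd s (f s))"
    and t: "t \<ge> 0"
  shows "conv f t - S t (unstable_int f)
       = conv (\<lambda>s. f s - P (f s)) t - (LINT s:{t<..}|lborel. bwd (s - t) (f s))"
    and "set_integrable lborel {t<..} (\<lambda>s. bwd (s - t) (f s))"
proof -
  have Pf: "continuous_on {0..} (\<lambda>s. P (f s))" by (intro continuous_intros f)
  have int': "set_integrable lborel {0..} (\<lambda>s. S t (bwd s (f s)))"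
    by (rule set_integral_blinfun(1)[OF int])
  have int1: "set_integrable lborel {0..t} (\<lambda>s. S t (bwd s (f s)))"
    and int2: "set_integrable lborel {t<..} (\<lambda>s. S t (bwd s (f s)))"
    using t by (auto intro: set_integrable_subset[OF int'])
  have eq: "(LINT s:{t<..}|lborel. S t (bwd s (f s))) = (LINT s:{t<..}|lborel. bwd (s - t) (f s))"
    by (rule set_lebesgue_integral_cong) (use t in \<open>auto simp: S_bwd_ge\<close>)
  have "S t (unstable_int f) = (LINT s:{0..}|lborel. S t (bwd s (f s)))"
    unfolding unstable_int_def by (rule set_integral_blinfun(2)[OF int, symmetric])
  also have "{0..} = {0..t} \<union> {t<..}" using t by auto
  also have "(LINT s:{0..t} \<union> {t<..}|lborel. S t (bwd s (f s))) =
      (LINT s:{0..t}|lborel. S t (bwd s (f s))) + (LINT s:{t<..}|lborel. S t (bwd s (f s)))"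
    by (rule set_integral_Un[OF _ int1 int2]) auto
  also have "(LINT s:{0..t}|lborel. S t (bwd s (f s))) = conv (\<lambda>s. P (f s)) t"
    unfolding conv_def by (rule set_lebesgue_integral_cong) (auto simp: S_bwd_le)
  finally show "conv f t - S t (unstable_int f)
       = conv (\<lambda>s. f s - P (f s)) t - (LINT s:{t<..}|lborel. bwd (s - t) (f s))"
    unfolding conv_diff[OF f Pf] eq by simp
  show "set_integrable lborel {t<..} (\<lambda>s. bwd (s - t) (f s))"
    using int2 by (rule set_integrable_cong[THEN iffD1, rotated -1]) (use t in \<open>auto simp: S_bwd_ge\<close>)
qed

text \<open>Each half of the dichotomy is integrated against the weight \<open>exp (\<eta> s)\<close>: the stable half,
  integrated up to \<open>t\<close>, is dominated by its upper end since \<open>\<beta> < \<eta>\<close>, and the other one,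
  integrated from \<open>t\<close> on, by its lower end since \<open>\<eta> < \<alpha>\<close>.\<close>
lemma norm_conv_minus_unstable:
  assumes f: "continuous_on {0..} f" and \<eta>: "\<beta> < \<eta>" "\<eta> < \<alpha>"
    and B: "\<And>s. s \<ge> 0 \<Longrightarrow> norm (f s) \<le> B * exp (\<eta> * s)" and t: "t \<ge> 0"
  shows "norm (conv f t - S t (unstable_int f))
       \<le> K * B * (1 / (\<alpha> - \<eta>) + 1 / (\<eta> - \<beta>)) * exp (\<eta> * t)"
proof -
  have int: "set_integrable lborel {0..} (\<lambda>s. bwd s (f s))" by (rule bwd_integrable[OF f \<eta>(2) B])
  note split = conv_minus_unstable[OF f int t]
  have B0: "B \<ge> 0" using order_trans[OF norm_ge_zero B[of 0]] by simp
  have Qf: "continuous_on {0..} (\<lambda>s. f s - P (f s))" by (intro continuous_intros f)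
  have "norm (conv (\<lambda>s. f s - P (f s)) t)
      \<le> (LINT s:{0..t}|lborel. K * B * exp (\<beta> * t) * exp ((\<eta> - \<beta>) * s))"
    unfolding conv_def
  proof (rule norm_set_integral_le[OF conv_integrable[OF Qf]])
    show "set_integrable lborel {0..t} (\<lambda>s. K * B * exp (\<beta> * t) * exp ((\<eta> - \<beta>) * s))"
      by (intro set_integrable_continuous_Icc continuous_intros)
    fix s assume s: "s \<in> {0..t}"
    have "norm (S (t - s) (f s - P (f s))) \<le> K * exp (\<beta> * (t - s)) * norm (f s)"
      by (rule norm_S_complement) (use s in auto)
    also have "\<dots> \<le> K * exp (\<beta> * (t - s)) * (B * exp (\<eta> * s))"
      using K_pos B s by (intro mult_left_mono) auto
    also have "\<dots> = K * B * (exp (\<beta> * (t - s)) * exp (\<eta> * s))" by (simp add: mult_ac)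
    also have "\<dots> = K * B * (exp (\<beta> * t) * exp ((\<eta> - \<beta>) * s))"
      by (simp add: exp_add[symmetric] algebra_simps)
    finally show "norm (S (t - s) (f s - P (f s))) \<le> K * B * exp (\<beta> * t) * exp ((\<eta> - \<beta>) * s)"
      by (simp add: mult_ac)
  qed
  also have "\<dots> = K * B * exp (\<beta> * t) * (LINT s:{0..t}|lborel. exp ((\<eta> - \<beta>) * s))" by simp
  also have "\<dots> \<le> K * B * exp (\<beta> * t) * (exp ((\<eta> - \<beta>) * t) / (\<eta> - \<beta>))"
    using set_integral_exp_Icc_le[of "\<eta> - \<beta>" t] \<eta> t K_pos B0 by (intro mult_left_mono) auto
  also have "\<dots> = K * B * (exp (\<beta> * t) * exp ((\<eta> - \<beta>) * t)) / (\<eta> - \<beta>)" by simp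
  also have "exp (\<beta> * t) * exp ((\<eta> - \<beta>) * t) = exp (\<eta> * t)"
    by (simp add: exp_add[symmetric] algebra_simps)
  finally have 1: "norm (conv (\<lambda>s. f s - P (f s)) t) \<le> K * B * exp (\<eta> * t) / (\<eta> - \<beta>)" .
  have w: "set_integrable lborel {t..} (\<lambda>s. K * B * exp (\<alpha> * t) * exp (- (\<alpha> - \<eta>) * s))"
    using set_integrable_exp_atLeast(1)[of "\<alpha> - \<eta>" t] \<eta> by (intro set_integrable_mult_right) auto
  have w': "set_integrable lborel {t<..} (\<lambda>s. K * B * exp (\<alpha> * t) * exp (- (\<alpha> - \<eta>) * s))"
    by (rule set_integrable_subset[OF w]) auto
  have "norm (LINT s:{t<..}|lborel. bwd (s - t) (f s))
      \<le> (LINT s:{t<..}|lborel. K * B * exp (\<alpha> * t) * exp (- (\<alpha> - \<eta>) * s))"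
    by (rule norm_set_integral_le[OF split(2) w']) (use t B norm_bwd_exp in auto)
  also have "\<dots> = (LINT s:{t..}|lborel. K * B * exp (\<alpha> * t) * exp (- (\<alpha> - \<eta>) * s))"
    unfolding set_lebesgue_integral_def
    by (rule integral_discrete_difference[where X = "{t}"]) (auto simp: indicator_def)
  also have "\<dots> = K * B * exp (\<alpha> * t) * (exp (- (\<alpha> - \<eta>) * t) / (\<alpha> - \<eta>))"
    using set_integrable_exp_atLeast(2)[of "\<alpha> - \<eta>" t] \<eta> by simp
  also have "\<dots> = K * B * (exp (\<alpha> * t) * exp (- (\<alpha> - \<eta>) * t)) / (\<alpha> - \<eta>)" by simp
  also have "exp (\<alpha> * t) * exp (- (\<alpha> - \<eta>) * t) = exp (\<eta> * t)"
    by (simp add: exp_add[symmetric] algebra_simps)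
  finally have 2: "norm (LINT s:{t<..}|lborel. bwd (s - t) (f s)) \<le> K * B * exp (\<eta> * t) / (\<alpha> - \<eta>)" .
  have "norm (conv f t - S t (unstable_int f))
     \<le> K * B * exp (\<eta> * t) / (\<eta> - \<beta>) + K * B * exp (\<eta> * t) / (\<alpha> - \<eta>)"
    unfolding split(1) using 1 2 by (intro norm_triangle_le_diff) linarith
  also have "\<dots> = K * B * (1 / (\<alpha> - \<eta>) + 1 / (\<eta> - \<beta>)) * exp (\<eta> * t)"
    by (simp add: algebra_simps)
  finally show ?thesis .
qed

text \<open>In place of Gronwall's inequality, the difference of two solutions is compared with itself at the
  point where its norm, weighted by \<open>exp (- \<mu> t)\<close>, is largest; for large \<open>\<mu>\<close> the integral
  equation halves that maximum.\<close>
lemma mild_unique: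
  assumes g: "\<And>s x y. s \<ge> 0 \<Longrightarrow> norm (g s x - g s y) \<le> L * norm (x - y)"
    and gc: "\<And>v. continuous_on {0..} v \<Longrightarrow> continuous_on {0..} (\<lambda>s. g s (v s))"
    and u: "continuous_on {0..} u" "\<And>t. t \<ge> 0 \<Longrightarrow> u t = S t x + conv (\<lambda>s. g s (u s)) t"
    and v: "continuous_on {0..} v" "\<And>t. t \<ge> 0 \<Longrightarrow> v t = S t x + conv (\<lambda>s. g s (v s)) t"
    and L: "L \<ge> 0" and N: "N \<ge> 0"
  shows "u N = v N"
proof -
  obtain M where M: "M > 0" "\<And>t x. 0 \<le> t \<Longrightarrow> t \<le> N \<Longrightarrow> norm (S t x) \<le> M * norm x"
    using S_locally_bounded[of N] by blast
  define C where "C = M * L + 1"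
  (* The integral of exp (mu s) costs a factor 1 / mu, so this choice gives the factor 1 / 2. *)
  define \<mu> where "\<mu> = 2 * C"
  have C: "C > 0" unfolding C_def using M(1) L by (intro add_nonneg_pos) auto
  have d: "continuous_on {0..N} (\<lambda>t. exp (- \<mu> * t) * norm (u t - v t))"
    by (intro continuous_intros continuous_on_subset[OF u(1)] continuous_on_subset[OF v(1)]) auto
  obtain t where t: "t \<in> {0..N}"
    and max: "\<And>s. s \<in> {0..N} \<Longrightarrow>
      exp (- \<mu> * s) * norm (u s - v s) \<le> exp (- \<mu> * t) * norm (u t - v t)"
    using continuous_attains_sup[OF _ _ d] N by auto
  define m where "m = exp (- \<mu> * t) * norm (u t - v t)"
  have m: "norm (u s - v s) \<le> m * exp (\<mu> * s)" if "s \<in> {0..N}" for s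
  proof -
    have "exp (- \<mu> * s) * norm (u s - v s) \<le> m" unfolding m_def by (rule max[OF that])
    then show ?thesis by (simp add: exp_minus field_simps)
  qed
  have m0: "m \<ge> 0" by (simp add: m_def)
  have cu: "continuous_on {0..} (\<lambda>s. g s (u s))" and cv: "continuous_on {0..} (\<lambda>s. g s (v s))"
    using gc u v by auto
  have cd: "continuous_on {0..} (\<lambda>s. g s (u s) - g s (v s))" by (intro continuous_intros cu cv)
  have "u t - v t = conv (\<lambda>s. g s (u s) - g s (v s)) t"
    using u(2)[of t] v(2)[of t] t conv_diff[OF cu cv] by simp
  also have "norm \<dots> \<le> (LINT s:{0..t}|lborel. C * m * exp (\<mu> * s))"
    unfolding conv_def
  proof (rule norm_set_integral_le[OF conv_integrable[OF cd]])
    show "set_integrable lborel {0..t} (\<lambda>s. C * m * exp (\<mu> * s))"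
      by (intro set_integrable_continuous_Icc continuous_intros)
    fix s assume s: "s \<in> {0..t}"
    have "norm (S (t - s) (g s (u s) - g s (v s))) \<le> M * norm (g s (u s) - g s (v s))"
      using s t by (intro M) auto
    also have "\<dots> \<le> M * (L * norm (u s - v s))"
      using M(1) s by (intro mult_left_mono g) auto
    also have "\<dots> \<le> C * norm (u s - v s)" by (simp add: C_def algebra_simps)
    also have "\<dots> \<le> C * (m * exp (\<mu> * s))" using C m[of s] s t by (intro mult_left_mono) auto
    finally show "norm (S (t - s) (g s (u s) - g s (v s))) \<le> C * m * exp (\<mu> * s)" by simp
  qed
  also have "\<dots> = C * m * (LINT s:{0..t}|lborel. exp (\<mu> * s))" by simp
  also have "\<dots> \<le> C * m * (exp (\<mu> * t) / \<mu>)"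
    using set_integral_exp_Icc_le[of \<mu> t] t C m0 by (intro mult_left_mono) (auto simp: \<mu>_def)
  also have "\<dots> = m * exp (\<mu> * t) / 2" using C by (simp add: \<mu>_def)
  also have "norm (u t - v t) = m * exp (\<mu> * t)" by (simp add: m_def exp_minus)
  finally have "m * exp (\<mu> * t) \<le> (m / 2) * exp (\<mu> * t)" by simp
  then have "m \<le> m / 2" by (subst (asm) mult_le_cancel_right_pos) simp_all
  then have "m = 0" using m0 by simp
  then show ?thesis using m[of N] N by simp
qed

section \<open>Shadowing by a solution on the graph\<close>

text \<open>Writing \<open>w t = exp (\<eta> t) y t\<close> turns the weighted space into the bounded continuous functions,
  which form a complete space; the arguments \<open>max 0 t\<close> only extend functions on the half-line to
  the whole line by constants. The fixed point of \<open>J\<close> is a mild solution by construction, because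
  \<open>R\<close> is the variation of constants formula with the initial value \<open>q y - unstable_int (f y)\<close>,
  and \<open>\<xi> y\<close> is the \<open>P\<close>-component of the corresponding starting point \<open>u 0 + w 0\<close>.\<close>
lemma shadowing_solution:
  fixes g :: "real \<Rightarrow> 'a \<Rightarrow> 'a" and h :: "'a \<Rightarrow> 'a"
  assumes \<eta>: "\<beta> < \<eta>" "\<eta> < \<alpha>"
    and g: "\<And>s x y. s \<ge> 0 \<Longrightarrow> norm (g s x - g s y) \<le> L * norm (x - y)"
    and gc: "\<And>v. continuous_on {0..} v \<Longrightarrow> continuous_on {0..} (\<lambda>s. g s (v s))"
    and h: "Lh-lipschitz_on (range P) h" and Ph: "\<And>\<xi>. \<xi> \<in> range P \<Longrightarrow> P (h \<xi>) = 0"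
    and L: "L \<ge> 0"
    and gap: "K * L * (1 / (\<alpha> - \<eta>) + 1 / (\<eta> - \<beta>)) + K\<^sup>2 * Lh * L * (1 / (\<alpha> - \<eta>)) < 1"
    and u: "continuous_on {0..} u" "\<And>t. t \<ge> 0 \<Longrightarrow> u t = S t x + conv (\<lambda>s. g s (u s)) t"
  obtains v \<xi> C where "continuous_on {0..} v" "\<xi> \<in> range P"
    "\<And>t. t \<ge> 0 \<Longrightarrow> v t = S t (\<xi> + h \<xi>) + conv (\<lambda>s. g s (v s)) t"
    "\<And>t. t \<ge> 0 \<Longrightarrow> norm (u t - v t) \<le> C * exp (\<eta> * t)"
proof -
  define w :: "(real \<Rightarrow>\<^sub>C 'a) \<Rightarrow> real \<Rightarrow> 'a" where "w y s = exp (\<eta> * s) *\<^sub>R y s" for y s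
  define f where "f y s = g s (u s + w y s) - g s (u s)" for y s
  define \<xi> where "\<xi> y = P x - unstable_int (f y)" for y
  define q where "q y = h (\<xi> y) - (x - P x)" for y
  define R where "R y t = S t (q y) + (conv (f y) t - S t (unstable_int (f y)))" for y t
  define J where "J y = Bcontfun (\<lambda>t. exp (- \<eta> * max 0 t) *\<^sub>R R y (max 0 t))" for y
  define c where "c = K * L * (1 / (\<alpha> - \<eta>) + 1 / (\<eta> - \<beta>)) + K\<^sup>2 * Lh * L * (1 / (\<alpha> - \<eta>))"
  have Lh: "Lh \<ge> 0" by (rule lipschitz_on_nonneg[OF h])
  have c: "0 \<le> c" "c < 1" using gap \<eta> L Lh K_pos by (auto simp: c_def intro!: add_nonneg_nonneg)
  have cw: "continuous_on {0..} (\<lambda>s. u s + w y s)" for y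
    unfolding w_def by (intro continuous_intros u(1) continuous_on_apply_bcontfun)
  have cf: "continuous_on {0..} (f y)" for y
    unfolding f_def by (intro continuous_intros gc cw u(1))
  have w0: "w 0 s = 0" for s by (simp add: w_def)
  have f0: "f 0 = (\<lambda>s. 0)" by (simp add: f_def w0 fun_eq_iff)
  have fd: "norm (f y s - f y' s) \<le> L * dist y y' * exp (\<eta> * s)" if "s \<ge> 0" for y y' s
  proof -
    have "f y s - f y' s = g s (u s + w y s) - g s (u s + w y' s)" by (simp add: f_def)
    also have "norm \<dots> \<le> L * norm (w y s - w y' s)" using g[OF that, of "u s + w y s" "u s + w y' s"] by simp
    also have "norm (w y s - w y' s) = exp (\<eta> * s) * norm (y s - y' s)"
      by (simp add: w_def scaleR_diff_right[symmetric])
    also have "L * (exp (\<eta> * s) * norm (y s - y' s)) \<le> L * (exp (\<eta> * s) * dist y y')"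
      using L dist_bounded[of y s y'] by (intro mult_left_mono) (auto simp: dist_norm)
    finally show ?thesis by (simp add: mult_ac)
  qed
  have fb: "norm (f y s) \<le> L * dist y 0 * exp (\<eta> * s)" if "s \<ge> 0" for y s
    using fd[OF that, of y 0] by (simp add: f0)
  note int = bwd_integrable[OF cf \<eta>(2) fb]
  have \<xi>_range: "\<xi> y \<in> range P" for y
    using P_unstable_int[OF int, of y] unfolding \<xi>_def by (metis blinfun.diff_right rangeI)
  have \<xi>d: "norm (\<xi> y - \<xi> y') \<le> K * (L * dist y y') / (\<alpha> - \<eta>)" for y y'
  proof -
    have "\<xi> y' - \<xi> y = unstable_int (\<lambda>s. f y s - f y' s)"
      by (simp add: \<xi>_def unstable_int_diff[OF int int])
    also have "norm \<dots> \<le> K * (L * dist y y') / (\<alpha> - \<eta>)"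
      by (intro norm_unstable_int continuous_intros cf \<eta>(2) fd)
    finally show ?thesis by (simp add: norm_minus_commute)
  qed
  have Pq: "P (q y) = 0" for y using Ph[OF \<xi>_range] by (simp add: q_def blinfun.diff_right P_idem)
  have Rd: "norm (R y t - R y' t) \<le> c * dist y y' * exp (\<eta> * t)" if t: "t \<ge> 0" for y y' t
  proof -
    have "norm (q y - q y') \<le> Lh * norm (\<xi> y - \<xi> y')"
      using lipschitz_onD[OF h \<xi>_range \<xi>_range, of y y'] by (simp add: q_def dist_norm)
    also have "\<dots> \<le> Lh * (K * (L * dist y y') / (\<alpha> - \<eta>))"
      using Lh \<xi>d by (intro mult_left_mono)
    finally have qd: "norm (q y - q y') \<le> Lh * (K * (L * dist y y') / (\<alpha> - \<eta>))" .
    have "norm (S t (q y - q y')) \<le> K * exp (\<beta> * t) * norm (q y - q y')"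
      using norm_S_complement[OF t, of "q y - q y'"] Pq by (simp add: blinfun.diff_right)
    also have "\<dots> \<le> K * exp (\<eta> * t) * (Lh * (K * (L * dist y y') / (\<alpha> - \<eta>)))"
      using K_pos \<eta> t qd by (intro mult_mono) (auto intro!: mult_right_mono)
    finally have 1: "norm (S t (q y - q y')) \<le> K\<^sup>2 * Lh * L * (1 / (\<alpha> - \<eta>)) * dist y y' * exp (\<eta> * t)"
      by (simp add: power2_eq_square mult_ac)
    have 2: "norm (conv (\<lambda>s. f y s - f y' s) t - S t (unstable_int (\<lambda>s. f y s - f y' s)))
        \<le> K * (L * dist y y') * (1 / (\<alpha> - \<eta>) + 1 / (\<eta> - \<beta>)) * exp (\<eta> * t)"
      by (intro norm_conv_minus_unstable continuous_intros cf \<eta> fd t)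
    have "R y t - R y' t = S t (q y - q y')
        + (conv (\<lambda>s. f y s - f y' s) t - S t (unstable_int (\<lambda>s. f y s - f y' s)))"
      by (simp add: R_def conv_diff[OF cf cf] unstable_int_diff[OF int int] blinfun.diff_right)
    also have "norm \<dots> \<le> K\<^sup>2 * Lh * L * (1 / (\<alpha> - \<eta>)) * dist y y' * exp (\<eta> * t)
        + K * (L * dist y y') * (1 / (\<alpha> - \<eta>) + 1 / (\<eta> - \<beta>)) * exp (\<eta> * t)"
      by (rule norm_triangle_mono[OF 1 2])
    also have "\<dots> = c * dist y y' * exp (\<eta> * t)" by (simp add: c_def algebra_simps)
    finally show ?thesis .
  qed
  (* For y = 0 the inhomogeneity vanishes; with the Lipschitz bound this keeps J y bounded. *)
  have R0: "norm (R 0 t) \<le> K * norm (q 0) * exp (\<eta> * t)" if t: "t \<ge> 0" for t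
  proof -
    have "R 0 t = S t (q 0 - P (q 0))"
      using norm_conv_minus_unstable[of "\<lambda>s. 0" \<eta> 0 t] \<eta> t Pq by (simp add: R_def f0)
    also have "norm \<dots> \<le> K * exp (\<beta> * t) * norm (q 0)" by (rule norm_S_complement[OF t])
    also have "\<dots> \<le> K * exp (\<eta> * t) * norm (q 0)"
      using K_pos \<eta> t by (intro mult_mono) (auto intro!: mult_right_mono)
    finally show ?thesis by (simp add: mult_ac)
  qed
  have cR: "continuous_on {0..} (R y)" for y
    unfolding R_def by (intro continuous_intros continuous_on_conv cf continuous_on_orbit)
  have scale: "norm (exp (- \<eta> * t) *\<^sub>R z) \<le> b" if "norm z \<le> b * exp (\<eta> * t)" for t z b
    using that by (simp add: exp_minus field_simps)
  have mem: "(\<lambda>t. exp (- \<eta> * max 0 t) *\<^sub>R R y (max 0 t)) \<in> bcontfun" for y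
  proof (rule bcontfun_normI)
    show "continuous_on UNIV (\<lambda>t. exp (- \<eta> * max 0 t) *\<^sub>R R y (max 0 t))"
      by (intro continuous_intros continuous_on_compose2[OF cR]) auto
    fix t :: real
    show "norm (exp (- \<eta> * max 0 t) *\<^sub>R R y (max 0 t)) \<le> c * dist y 0 + K * norm (q 0)"
    proof (rule scale)
      have "norm (R y (max 0 t)) \<le> norm (R y (max 0 t) - R 0 (max 0 t)) + norm (R 0 (max 0 t))"
        by (metis diff_add_cancel norm_triangle_ineq)
      also have "\<dots> \<le> (c * dist y 0 + K * norm (q 0)) * exp (\<eta> * max 0 t)"
        using Rd[of "max 0 t" y 0] R0[of "max 0 t"] by (simp add: algebra_simps)
      finally show "norm (R y (max 0 t)) \<le> (c * dist y 0 + K * norm (q 0)) * exp (\<eta> * max 0 t)" .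
    qed
  qed
  have J: "J y t = exp (- \<eta> * max 0 t) *\<^sub>R R y (max 0 t)" for y t
    unfolding J_def using Bcontfun_inverse[OF mem] by simp
  have "dist (J y) (J y') \<le> c * dist y y'" for y y'
  proof (rule dist_bound)
    fix t :: real
    show "dist (J y t) (J y' t) \<le> c * dist y y'"
      unfolding dist_norm[of "J y t" "J y' t"] unfolding J scaleR_diff_right[symmetric] by (intro scale Rd) auto
  qed
  then obtain y where y: "J y = y" using banach_fix_type[OF c, of J] by blast
  have wR: "w y t = R y t" if "t \<ge> 0" for t
    using J[of y t] that unfolding y by (simp add: w_def exp_minus)
  define v where "v t = u t + w y t" for t
  have cv: "continuous_on {0..} v" unfolding v_def by (rule cw)
  show ?thesis
  proof (rule that[OF cv \<xi>_range[of y]])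
    fix t :: real assume t: "t \<ge> 0"
    have "conv (f y) t = conv (\<lambda>s. g s (v s)) t - conv (\<lambda>s. g s (u s)) t"
      unfolding f_def v_def by (intro conv_diff gc cw u(1))
    then show "v t = S t (\<xi> y + h (\<xi> y)) + conv (\<lambda>s. g s (v s)) t"
      using u(2)[OF t] by (simp add: v_def wR[OF t] R_def q_def \<xi>_def blinfun.add_right blinfun.diff_right)
    have "norm (y t) \<le> norm y" using dist_bounded[of y t 0] by (simp add: dist_norm)
    then show "norm (u t - v t) \<le> norm y * exp (\<eta> * t)" by (simp add: v_def w_def mult.commute)
  qed
qed

end

section \<open>Removing the noise\<close>

context
  fixes W \<Omega> \<omega>
  assumes noise: "noise_space W \<Omega>" and \<omega>: "\<omega> \<in> \<Omega>"
begin

lemma ou_int_eq: "ou_int \<omega> s t = ou_int \<omega> 0 t - ou_int \<omega> 0 s"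
proof -
  have c: "continuous_on A (\<lambda>r. ou (theta r \<omega>))" for A
    using noise \<omega> unfolding noise_space_def by (meson continuous_on_subset subset_UNIV)
  have "interval_lebesgue_integrable lborel (ereal (min 0 (min s t))) (ereal (max 0 (max s t))) (\<lambda>r. ou (theta r \<omega>))"
    by (rule interval_integrable_continuous_on[OF _ c]) auto
  then have "(LBINT r=ereal 0..ereal s. ou (theta r \<omega>)) + (LBINT r=ereal s..ereal t. ou (theta r \<omega>))
     = (LBINT r=ereal 0..ereal t. ou (theta r \<omega>))"
    by (intro interval_integral_sum) (simp only: ereal_min ereal_max)
  then show ?thesis by (simp add: ou_int_def)
qed

lemma continuous_on_ou_int: "continuous_on {0..} (\<lambda>t. ou_int \<omega> 0 t)"
proof (rule continuous_on_atLeast_from_Icc)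
  fix N :: real
  have c: "continuous_on A (\<lambda>r. ou (theta r \<omega>))" for A
    using noise \<omega> unfolding noise_space_def by (meson continuous_on_subset subset_UNIV)
  have "continuous_on {0..N} (\<lambda>t. integral {0..t} (\<lambda>r. ou (theta r \<omega>)))"
    by (intro indefinite_integral_continuous_1 integrable_continuous_interval c)
  then show "continuous_on {0..N} (\<lambda>t. ou_int \<omega> 0 t)"
    by (rule continuous_on_eq)
       (auto simp: ou_int_def intro!: interval_integral_eq_integral[symmetric] set_integrable_continuous_Icc c)
qed

text \<open>The time average of the Ornstein--Uhlenbeck process tends to zero, so its integral eventually stays
  below \<open>c * t\<close>; up to that time it is bounded by compactness.\<close>
lemma ou_int_sublinear:
  assumes "c > 0"
  obtains C where "C > 0" "\<And>t. t \<ge> 0 \<Longrightarrow> exp (ou_int \<omega> 0 t) \<le> C * exp (c * t)"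
proof -
  have "((\<lambda>t. (1 / t) * ou_int \<omega> 0 t) \<longlongrightarrow> 0) at_top"
    using noise \<omega> unfolding noise_space_def by blast
  then have "eventually (\<lambda>t. (1 / t) * ou_int \<omega> 0 t < c) at_top"
    using assms by (rule order_tendstoD)
  then obtain T where T: "\<And>t. t \<ge> T \<Longrightarrow> (1 / t) * ou_int \<omega> 0 t < c"
    by (auto simp: eventually_at_top_linorder)
  define T' where "T' = max T 1"
  have "compact (ou_int \<omega> 0 ` {0..T'})"
    by (intro compact_continuous_image continuous_on_subset[OF continuous_on_ou_int]) auto
  then obtain B where B: "\<And>t. t \<in> {0..T'} \<Longrightarrow> norm (ou_int \<omega> 0 t) \<le> B"
    by (meson bounded_iff compact_imp_bounded imageI)
  have B0: "B \<ge> 0" using order_trans[OF norm_ge_zero B[of 0]] by (simp add: T'_def)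
  have "exp (ou_int \<omega> 0 t) \<le> exp B * exp (c * t)" if "t \<ge> 0" for t
  proof (cases "t \<le> T'")
    case True
    then have "ou_int \<omega> 0 t \<le> B" using B[of t] that by auto
    moreover have "0 \<le> c * t" using assms that by simp
    ultimately show ?thesis by (simp add: exp_add[symmetric])
  next
    case False
    then have t: "t \<ge> T" "t > 0" by (auto simp: T'_def)
    then have "ou_int \<omega> 0 t < c * t" using T[OF t(1)] by (simp add: field_simps)
    then show ?thesis using B0 by (simp add: exp_add[symmetric])
  qed
  then show ?thesis using that[of "exp B"] by simp
qed

end

text \<open>The nonlinearity of the equation satisfied by \<open>exp (- ou_int \<omega> 0 t) u t\<close>.\<close>
definition noiseless_G :: "('a::real_normed_vector \<Rightarrow> 'a) \<Rightarrow> (real \<Rightarrow> real) \<Rightarrow> real \<Rightarrow> 'a \<Rightarrow> 'a" where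
  "noiseless_G F \<omega> s y = exp (- ou_int \<omega> 0 s) *\<^sub>R G_of F (theta s \<omega>) (exp (ou_int \<omega> 0 s) *\<^sub>R y)"

lemma (in dichotomous_semigroup) mild_solution_iff:
  assumes noise: "noise_space W \<Omega>" "\<omega> \<in> \<Omega>"
  defines "Z \<equiv> ou_int \<omega> 0"
  shows "mild_solution S F \<omega> x u \<longleftrightarrow>
     continuous_on {0..} (\<lambda>t. exp (- Z t) *\<^sub>R u t) \<and>
     (\<forall>t\<ge>0. exp (- Z t) *\<^sub>R u t
        = S t x + conv (\<lambda>s. noiseless_G F \<omega> s (exp (- Z s) *\<^sub>R u s)) t)"
proof -
  have cZ: "continuous_on {0..} Z" unfolding Z_def by (rule continuous_on_ou_int[OF noise])
  have "continuous_on {0..} u \<longleftrightarrow> continuous_on {0..} (\<lambda>t. exp (- Z t) *\<^sub>R u t)"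
  proof
    assume "continuous_on {0..} (\<lambda>t. exp (- Z t) *\<^sub>R u t)"
    then have "continuous_on {0..} (\<lambda>t. exp (Z t) *\<^sub>R exp (- Z t) *\<^sub>R u t)"
      by (rule continuous_on_scaleR[OF continuous_on_exp[OF cZ]])
    then show "continuous_on {0..} u" by (simp add: exp_minus)
  qed (intro continuous_intros cZ)
  moreover have "u t = exp (ou_int \<omega> 0 t) *\<^sub>R S t x +
        (LBINT s=0..ereal t. exp (ou_int \<omega> s t) *\<^sub>R S (t - s) (G_of F (theta s \<omega>) (u s)))
     \<longleftrightarrow> exp (- Z t) *\<^sub>R u t
        = S t x + conv (\<lambda>s. noiseless_G F \<omega> s (exp (- Z s) *\<^sub>R u s)) t" if t: "t \<ge> 0" for t
  proof -
    have "(LBINT s=0..ereal t. exp (ou_int \<omega> s t) *\<^sub>R S (t - s) (G_of F (theta s \<omega>) (u s)))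
       = (LINT s:{0..t}|lborel. exp (ou_int \<omega> s t) *\<^sub>R S (t - s) (G_of F (theta s \<omega>) (u s)))"
      unfolding zero_ereal_def by (rule interval_integral_Icc) (use t in simp)
    also have "\<dots> = (LINT s:{0..t}|lborel.
        exp (Z t) *\<^sub>R S (t - s) (noiseless_G F \<omega> s (exp (- Z s) *\<^sub>R u s)))"
    proof (rule set_lebesgue_integral_cong, simp, intro allI impI)
      fix s
      have "ou_int \<omega> s t = Z t - Z s" unfolding Z_def by (rule ou_int_eq[OF noise])
      moreover have "noiseless_G F \<omega> s (exp (- Z s) *\<^sub>R u s) = exp (- Z s) *\<^sub>R G_of F (theta s \<omega>) (u s)"
        by (simp add: noiseless_G_def Z_def exp_minus)
      ultimately show "exp (ou_int \<omega> s t) *\<^sub>R S (t - s) (G_of F (theta s \<omega>) (u s))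
          = exp (Z t) *\<^sub>R S (t - s) (noiseless_G F \<omega> s (exp (- Z s) *\<^sub>R u s))"
        by (simp add: blinfun.scaleR_right exp_diff exp_minus divide_inverse)
    qed
    also have "\<dots> = exp (Z t) *\<^sub>R conv (\<lambda>s. noiseless_G F \<omega> s (exp (- Z s) *\<^sub>R u s)) t"
      by (simp add: conv_def)
    finally have eq: "exp (ou_int \<omega> 0 t) *\<^sub>R S t x +
        (LBINT s=0..ereal t. exp (ou_int \<omega> s t) *\<^sub>R S (t - s) (G_of F (theta s \<omega>) (u s)))
      = exp (Z t) *\<^sub>R (S t x + conv (\<lambda>s. noiseless_G F \<omega> s (exp (- Z s) *\<^sub>R u s)) t)"
      by (simp add: Z_def scaleR_add_right)
    have inv: "a = exp r *\<^sub>R b \<longleftrightarrow> exp (- r) *\<^sub>R a = b" for a b :: 'a and r :: real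
      by (auto simp: exp_minus)
    show ?thesis unfolding eq by (rule inv)
  qed
  ultimately show ?thesis unfolding mild_solution_def by blast
qed

text \<open>\<open>noiseless_G F \<omega> s\<close> is \<open>F\<close> conjugated by a positive scalar, which preserves Lipschitz
  constants.\<close>
lemma norm_noiseless_G_diff:
  assumes "L-lipschitz_on UNIV F"
  shows "norm (noiseless_G F \<omega> s x - noiseless_G F \<omega> s y) \<le> L * norm (x - y)"
proof -
  define r where "r = ou (theta s \<omega>) + ou_int \<omega> 0 s"
  have r: "noiseless_G F \<omega> s x = exp (- r) *\<^sub>R F (exp r *\<^sub>R x)" for x
  proof -
    have "exp (- r) = exp (- ou_int \<omega> 0 s) * exp (- ou (theta s \<omega>))"
      by (simp add: r_def exp_add[symmetric])
    moreover have "exp r = exp (ou (theta s \<omega>)) * exp (ou_int \<omega> 0 s)"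
      by (simp add: r_def exp_add)
    ultimately show ?thesis by (simp add: noiseless_G_def G_of_def)
  qed
  have "norm (F (exp r *\<^sub>R x) - F (exp r *\<^sub>R y)) \<le> L * norm (exp r *\<^sub>R x - exp r *\<^sub>R y)"
    using lipschitz_onD[OF assms, of "exp r *\<^sub>R x" "exp r *\<^sub>R y"] by (simp add: dist_norm)
  also have "\<dots> = L * (exp r * norm (x - y))" by (simp add: scaleR_diff_right[symmetric])
  finally have le: "norm (F (exp r *\<^sub>R x) - F (exp r *\<^sub>R y)) \<le> L * (exp r * norm (x - y))" .
  have "norm (noiseless_G F \<omega> s x - noiseless_G F \<omega> s y)
      = exp (- r) * norm (F (exp r *\<^sub>R x) - F (exp r *\<^sub>R y))"
    unfolding r scaleR_diff_right[symmetric] by simp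
  also have "\<dots> \<le> exp (- r) * (L * (exp r * norm (x - y)))" by (rule mult_left_mono[OF le]) simp
  also have "\<dots> = L * norm (x - y)" by (simp add: exp_minus)
  finally show ?thesis .
qed

lemma continuous_on_noiseless_G:
  assumes noise: "noise_space W \<Omega>" "\<omega> \<in> \<Omega>" and F: "L-lipschitz_on UNIV F"
    and v: "continuous_on {0..} v"
  shows "continuous_on {0..} (\<lambda>s. noiseless_G F \<omega> s (v s))"
proof -
  have z: "continuous_on {0..} (\<lambda>r. ou (theta r \<omega>))"
    using noise unfolding noise_space_def by (meson continuous_on_subset subset_UNIV)
  show ?thesis unfolding noiseless_G_def G_of_def
    by (intro continuous_intros z continuous_on_ou_int[OF noise] v
        continuous_on_compose2[OF lipschitz_on_continuous_on[OF F]]) auto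
qed

text \<open>The integrand lies in the kernel of \<open>P\<close> whatever function \<open>backward_sol\<close> is; should the
  integral diverge, its value 0 is in the kernel too.\<close>
lemma (in dichotomous_semigroup) P_graph_map: "P (graph_map S P F \<eta> \<omega> \<xi>) = 0"
proof -
  define k where "k s = (let g = G_of F (theta s \<omega>) (backward_sol S P F \<eta> \<omega> \<xi> s)
         in exp (ou_int \<omega> s 0) *\<^sub>R expA S P (- s) (g - P g))" for s
  have k: "P (k s) = 0" if "s \<in> einterval (-\<infinity>) 0" for s
    using that by (auto simp: k_def einterval_iff Let_def expA_def blinfun.scaleR_right P_S
        blinfun.diff_right P_idem zero_ereal_def)
  have "graph_map S P F \<eta> \<omega> \<xi> = (LINT s:einterval (-\<infinity>) 0|lborel. k s)"
    unfolding graph_map_def k_def by (simp add: interval_lebesgue_integral_def)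
  also have "P \<dots> = 0"
  proof (cases "set_integrable lborel (einterval (-\<infinity>) 0) k")
    case True
    have "P (LINT s:einterval (-\<infinity>) 0|lborel. k s) = (LINT s:einterval (-\<infinity>) 0|lborel. P (k s))"
      by (rule set_integral_blinfun(2)[OF True, symmetric])
    also have "\<dots> = (LINT s:einterval (-\<infinity>) 0|lborel. 0)"
      by (rule set_lebesgue_integral_cong) (use k in auto)
    finally show ?thesis by (simp add: set_lebesgue_integral_def)
  next
    case False
    then show ?thesis
      by (simp add: set_integrable_def set_lebesgue_integral_def not_integrable_integral_eq blinfun.zero_right)
  qed
  finally show ?thesis .
qed

section \<open>Asymptotic completeness\<close>

theorem theorem2p2:
  fixes W :: "(real \<Rightarrow> real) measure" and \<Omega> :: "(real \<Rightarrow> real) set"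
    and A :: "'a::{real_inner, banach, second_countable_topology} \<Rightarrow> 'a" and D :: "'a set"
    and S :: "real \<Rightarrow> 'a \<Rightarrow>\<^sub>L 'a"
    and P :: "'a \<Rightarrow>\<^sub>L 'a"
    and F :: "'a \<Rightarrow> 'a"
    and \<phi> :: "real \<Rightarrow> (real \<Rightarrow> real) \<Rightarrow> 'a \<Rightarrow> 'a"
    and \<alpha> \<beta> \<eta> K LipF Liph :: real
  assumes noise: "noise_space W \<Omega>"
    and semigroup: "generates A D S"
    and dichotomy: "pseudo_exp_dichotomy S P \<alpha> \<beta> K"
    and LipF: "LipF-lipschitz_on UNIV F"
    and rds: "\<And>\<omega> x. \<omega> \<in> \<Omega> \<Longrightarrow> mild_solution S F \<omega> x (\<lambda>t. \<phi> t \<omega> x)"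
    and eta: "\<eta> \<in> {\<beta><..<\<alpha>}"
    and Liph: "\<And>\<omega>. \<omega> \<in> \<Omega> \<Longrightarrow> Liph-lipschitz_on (range P) (graph_map S P F \<eta> \<omega>)"
    and gap: "K * LipF * (1 / (\<alpha> - \<eta>) + 1 / (\<eta> - \<beta>))
                + K\<^sup>2 * Liph * LipF * (1 / (\<alpha> - \<eta>)) < 1"
  shows "\<exists>c\<^sub>2>0. \<forall>\<omega>\<in>\<Omega>. \<forall>x. \<exists>xbar\<in>inv_manifold S P F \<eta> \<omega>. \<exists>c\<^sub>1>0. \<forall>t\<ge>0.
           norm (\<phi> t \<omega> x - \<phi> t \<omega> xbar) \<le> c\<^sub>1 * exp (- c\<^sub>2 * t) * norm (x - xbar)"
proof -
  interpret dichotomous_semigroup S P \<alpha> \<beta> K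
    by unfold_locales (use semigroup dichotomy in \<open>auto simp: generates_def\<close>)
  have \<eta>: "\<beta> < \<eta>" "\<eta> < \<alpha>" using eta by auto
  then have \<eta>_neg: "\<eta> < 0" using \<alpha>_neg by simp
  have "\<exists>xbar\<in>inv_manifold S P F \<eta> \<omega>. \<exists>c\<^sub>1>0. \<forall>t\<ge>0.
       norm (\<phi> t \<omega> x - \<phi> t \<omega> xbar) \<le> c\<^sub>1 * exp (- (- \<eta> / 2) * t) * norm (x - xbar)"
    if \<omega>: "\<omega> \<in> \<Omega>" for \<omega> x
  proof -
    define Z where "Z = ou_int \<omega> 0"
    define g where "g = noiseless_G F \<omega>"
    define u where "u x t = exp (- Z t) *\<^sub>R \<phi> t \<omega> x" for x t
    have u: "continuous_on {0..} (u x)" "\<And>t. t \<ge> 0 \<Longrightarrow> u x t = S t x + conv (\<lambda>s. g s (u x s)) t" for x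
      using mild_solution_iff[OF noise \<omega>, THEN iffD1, OF rds[OF \<omega>, of x]]
      by (auto simp: Z_def u_def[abs_def] g_def)
    have g: "norm (g s x - g s y) \<le> LipF * norm (x - y)" for s x y
      unfolding g_def by (rule norm_noiseless_G_diff[OF LipF])
    have gc: "continuous_on {0..} (\<lambda>s. g s (v s))" if "continuous_on {0..} v" for v
      unfolding g_def by (rule continuous_on_noiseless_G[OF noise \<omega> LipF that])
    obtain v \<xi> C where v: "continuous_on {0..} v" and \<xi>: "\<xi> \<in> range P"
      and v_mild: "\<And>t. t \<ge> 0 \<Longrightarrow> v t = S t (\<xi> + graph_map S P F \<eta> \<omega> \<xi>) + conv (\<lambda>s. g s (v s)) t"
      and close: "\<And>t. t \<ge> 0 \<Longrightarrow> norm (u x t - v t) \<le> C * exp (\<eta> * t)"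
      using shadowing_solution[OF \<eta> g gc Liph[OF \<omega>] P_graph_map lipschitz_on_nonneg[OF LipF] gap u]
      by blast
    define xbar where "xbar = \<xi> + graph_map S P F \<eta> \<omega> \<xi>"
    have mem: "xbar \<in> inv_manifold S P F \<eta> \<omega>" unfolding inv_manifold_def xbar_def using \<xi> by blast
    have uv: "u xbar t = v t" if "t \<ge> 0" for t
      using mild_unique[OF g gc u v v_mild lipschitz_on_nonneg[OF LipF] that] by (simp add: xbar_def)
    obtain C' where C': "C' > 0" "\<And>t. t \<ge> 0 \<Longrightarrow> exp (Z t) \<le> C' * exp (- \<eta> / 2 * t)"
      using ou_int_sublinear[OF noise \<omega>, of "- \<eta> / 2"] \<eta>_neg unfolding Z_def by auto
    have bound: "norm (\<phi> t \<omega> x - \<phi> t \<omega> xbar) \<le> C' * \<bar>C\<bar> * exp (- (- \<eta> / 2) * t)" if t: "t \<ge> 0" for t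
    proof -
      have "\<phi> t \<omega> x - \<phi> t \<omega> xbar = exp (Z t) *\<^sub>R (u x t - u xbar t)"
        by (simp add: u_def scaleR_diff_right exp_minus)
      also have "norm \<dots> = exp (Z t) * norm (u x t - v t)" using uv[OF t] by simp
      also have "\<dots> \<le> (C' * exp (- \<eta> / 2 * t)) * (\<bar>C\<bar> * exp (\<eta> * t))"
        using C' t close[OF t]
        by (intro mult_mono) (auto intro: order_trans[OF _ mult_right_mono[OF abs_ge_self]])
      also have "\<dots> = C' * \<bar>C\<bar> * (exp (- \<eta> / 2 * t) * exp (\<eta> * t))" by (simp add: mult_ac)
      also have "exp (- \<eta> / 2 * t) * exp (\<eta> * t) = exp (- (- \<eta> / 2) * t)"
        by (simp add: exp_add[symmetric])
      finally show ?thesis .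
    qed
    show ?thesis
    proof (cases "x = xbar")
      case True
      then show ?thesis using mem by (intro bexI[of _ xbar] exI[of _ 1]) auto
    next
      case False
      (* The constant may depend on both points, so it can absorb the distance between them. *)
      define c\<^sub>1 where "c\<^sub>1 = (C' * \<bar>C\<bar> + 1) / norm (x - xbar)"
      have c1: "c\<^sub>1 > 0" "c\<^sub>1 * norm (x - xbar) = C' * \<bar>C\<bar> + 1"
        using False C'(1) by (auto simp: c\<^sub>1_def intro!: divide_pos_pos add_nonneg_pos)
      have "norm (\<phi> t \<omega> x - \<phi> t \<omega> xbar) \<le> c\<^sub>1 * exp (- (- \<eta> / 2) * t) * norm (x - xbar)" if "t \<ge> 0" for t
      proof -
        have "norm (\<phi> t \<omega> x - \<phi> t \<omega> xbar) \<le> (C' * \<bar>C\<bar> + 1) * exp (- (- \<eta> / 2) * t)"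
          using bound[OF that] by (rule order_trans) (intro mult_right_mono, auto)
        then show ?thesis by (simp add: c1(2)[symmetric] mult_ac)
      qed
      then show ?thesis using mem c1(1) by blast
    qed
  qed
  (* Half of the rate eta is spent on the growth of exp (Z t). *)
  then show ?thesis using \<eta>_neg by (intro exI[of _ "- \<eta> / 2"]) auto
qed

end
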